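(* Let $\mathcal A=(A,\le_A)$, $\mathcal B=(B,\le_B)$ be finite nonempty posets with $A,B$ disjoint, let $a\in A$, and put $A\sqcup_a B:=(A\setminus\{a\})\sqcup B$. Let $\mathcal A\blacktriangle_a\mathcal B$ be the set $A\sqcup_a B$ with the partial order: $x\le y$ if and only if ($x,y\in B$ and $x\le_B y$), or ($x,y\in A\setminus\{a\}$ and $x\le_A y$), or ($x\in A\setminus\{a\}$, $y\in\max\mathcal B$ and $x\le_A a$), or ($x\in B$, $y\in A\setminus\{a\}$ and $a\le_A y$). Let $\mathcal A\blacktriangledown_a\mathcal B$ be the set $A\sqcup_a B$ with the partial order: $x\le y$ if and only if ($x,y\in B$ and $x\le_B y$), or ($x,y\in A\setminus\{a\}$ and $x\le_A y$), or ($x\in A\setminus\{a\}$, $y\in B$ and $x\le_A a$), or ($x\in\min\mathcal B$, $y\in A\setminus\{a\}$ and $a\le_A y$). Then each of the two families of partial compositions $\blacktriangle_a$ and $\blacktriangledown_a$ endows the species of finite posets with a set operad structure.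
   Context: $\min\mathcal B$ and $\max\mathcal B$ denote the sets of minimal and maximal elements of $\mathcal B$. The set species of finite posets assigns to each finite nonempty set $A$ the set of all partial orders on $A$; bijections act by relabelling. A set operad structure on a set species $\mathbb P$, in terms of partial compositions, is a family of maps $\star_a:\mathbb P_A\times\mathbb P_B\to\mathbb P_{A\sqcup_a B}$ ($A,B$ disjoint finite sets, $a\in A$), natural with respect to relabelling bijections, such that for $X\in\mathbb P_A$, $Y\in\mathbb P_B$, $Z\in\mathbb P_C$ with $A,B,C$ pairwise disjoint: (parallel associativity) $(X\star_aY)\star_{a'}Z=(X\star_{a'}Z)\star_aY$ for $a\ne a'$ in $A$; (nested associativity) $(X\star_aY)\star_bZ=X\star_a(Y\star_bZ)$ for $a\in A$, $b\in B$; together with units in $\mathbb P_{\{a\}}$ (here the one-point posets): $1_{\{a\}}\star_aY=Y$ and $X\star_a1_{\{b\}}$ is $X$ with $a$ relabelled $b$. *)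

theory Defs
  imports Main
begin

(* A set species on finite nonempty subsets of 'a: P A is the set of structures on A, and
   T A f transports a structure on A along a bijection f from A onto f ` A. Only the values
   of f on A matter (transport_cong). *)
locale set_species =
  fixes P :: "'a set \<Rightarrow> 'p set"
    and T :: "'a set \<Rightarrow> ('a \<Rightarrow> 'a) \<Rightarrow> 'p \<Rightarrow> 'p"
  assumes transport_in:
      "\<lbrakk>finite A; A \<noteq> {}; bij_betw f A B; X \<in> P A\<rbrakk> \<Longrightarrow> T A f X \<in> P B"
    and transport_cong:
      "\<lbrakk>finite A; A \<noteq> {}; inj_on f A; \<And>x. x \<in> A \<Longrightarrow> f x = g x; X \<in> P A\<rbrakk> \<Longrightarrow> T A f X = T A g X"
    and transport_id:
      "\<lbrakk>finite A; A \<noteq> {}; X \<in> P A\<rbrakk> \<Longrightarrow> T A (\<lambda>x. x) X = X"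
    and transport_comp:
      "\<lbrakk>finite A; A \<noteq> {}; bij_betw f A B; bij_betw g B C; X \<in> P A\<rbrakk>
        \<Longrightarrow> T A (g \<circ> f) X = T B g (T A f X)"

definition insert_at :: "'a set \<Rightarrow> 'a \<Rightarrow> 'a set \<Rightarrow> 'a set" where
  "insert_at A a B = (A - {a}) \<union> B"

(* star A a B X Y is the partial composition of X in P A with Y in P B at the point a of A. *)
locale set_operad = set_species P T
  for P :: "'a set \<Rightarrow> 'p set"
    and T :: "'a set \<Rightarrow> ('a \<Rightarrow> 'a) \<Rightarrow> 'p \<Rightarrow> 'p" +
  fixes star :: "'a set \<Rightarrow> 'a \<Rightarrow> 'a set \<Rightarrow> 'p \<Rightarrow> 'p \<Rightarrow> 'p"
    and one :: "'a \<Rightarrow> 'p"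
  assumes star_in:
      "\<lbrakk>finite A; finite B; B \<noteq> {}; A \<inter> B = {}; a \<in> A; X \<in> P A; Y \<in> P B\<rbrakk>
        \<Longrightarrow> star A a B X Y \<in> P (insert_at A a B)"
    and star_natural:
      "\<lbrakk>finite A; finite B; B \<noteq> {}; A \<inter> B = {}; a \<in> A; X \<in> P A; Y \<in> P B;
        bij_betw f A A'; bij_betw g B B'; A' \<inter> B' = {}\<rbrakk>
        \<Longrightarrow> T (insert_at A a B) (\<lambda>x. if x \<in> B then g x else f x) (star A a B X Y)
          = star A' (f a) B' (T A f X) (T B g Y)"
    and parallel_assoc:
      "\<lbrakk>finite A; finite B; B \<noteq> {}; finite C; C \<noteq> {};
        A \<inter> B = {}; A \<inter> C = {}; B \<inter> C = {}; a \<in> A; a' \<in> A; a \<noteq> a';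
        X \<in> P A; Y \<in> P B; Z \<in> P C\<rbrakk>
        \<Longrightarrow> star (insert_at A a B) a' C (star A a B X Y) Z
          = star (insert_at A a' C) a B (star A a' C X Z) Y"
    and nested_assoc:
      "\<lbrakk>finite A; finite B; finite C; C \<noteq> {};
        A \<inter> B = {}; A \<inter> C = {}; B \<inter> C = {}; a \<in> A; b \<in> B;
        X \<in> P A; Y \<in> P B; Z \<in> P C\<rbrakk>
        \<Longrightarrow> star (insert_at A a B) b C (star A a B X Y) Z
          = star A a (insert_at B b C) X (star B b C Y Z)"
    and one_in: "one a \<in> P {a}"
    and left_unit:
      "\<lbrakk>finite B; B \<noteq> {}; a \<notin> B; Y \<in> P B\<rbrakk> \<Longrightarrow> star {a} a B (one a) Y = Y"
    and right_unit:
      "\<lbrakk>finite A; a \<in> A; b \<notin> A; X \<in> P A\<rbrakk>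
        \<Longrightarrow> star A a {b} X (one b) = T A (\<lambda>x. if x = a then b else x) X"

(* A partial order on A is given by its graph: (x, y) \<in> r means x \<le> y. *)
definition posets :: "'a set \<Rightarrow> 'a rel set" where
  "posets A = {r. partial_order_on A r}"

definition relabel :: "'a set \<Rightarrow> ('a \<Rightarrow> 'a) \<Rightarrow> 'a rel \<Rightarrow> 'a rel" where
  "relabel A f r = {(f x, f y) |x y. x \<in> A \<and> y \<in> A \<and> (x, y) \<in> r}"

definition min_set :: "'a set \<Rightarrow> 'a rel \<Rightarrow> 'a set" where
  "min_set B s = {x \<in> B. \<forall>y\<in>B. (y, x) \<in> s \<longrightarrow> y = x}"

definition max_set :: "'a set \<Rightarrow> 'a rel \<Rightarrow> 'a set" where
  "max_set B s = {x \<in> B. \<forall>y\<in>B. (x, y) \<in> s \<longrightarrow> y = x}"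

definition one_point_poset :: "'a \<Rightarrow> 'a rel" where
  "one_point_poset a = {(a, a)}"

definition tri_up :: "'a set \<Rightarrow> 'a \<Rightarrow> 'a set \<Rightarrow> 'a rel \<Rightarrow> 'a rel \<Rightarrow> 'a rel" where
  "tri_up A a B r s = {(x, y).
      (x \<in> B \<and> y \<in> B \<and> (x, y) \<in> s) \<or>
      (x \<in> A - {a} \<and> y \<in> A - {a} \<and> (x, y) \<in> r) \<or>
      (x \<in> A - {a} \<and> y \<in> max_set B s \<and> (x, a) \<in> r) \<or>
      (x \<in> B \<and> y \<in> A - {a} \<and> (a, y) \<in> r)}"

definition tri_down :: "'a set \<Rightarrow> 'a \<Rightarrow> 'a set \<Rightarrow> 'a rel \<Rightarrow> 'a rel \<Rightarrow> 'a rel" where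
  "tri_down A a B r s = {(x, y).
      (x \<in> B \<and> y \<in> B \<and> (x, y) \<in> s) \<or>
      (x \<in> A - {a} \<and> y \<in> A - {a} \<and> (x, y) \<in> r) \<or>
      (x \<in> A - {a} \<and> y \<in> B \<and> (x, a) \<in> r) \<or>
      (x \<in> min_set B s \<and> y \<in> A - {a} \<and> (a, y) \<in> r)}"

end

theory Submission
  imports Defs
begin

text \<open>
  Only the orders \<open>\<blacktriangle>\<close> need work, since \<open>\<blacktriangledown>\<close> is obtained from \<open>\<blacktriangle>\<close> by reversing all orders.
  Every axiom for \<open>\<blacktriangle>\<close> is a comparison of relations case by case, except nested associativity.
  That one needs the maximal elements of \<open>\<B> \<blacktriangle>\<^sub>b \<C>\<close>: they are the elements of \<open>max \<B>\<close>
  other than \<open>b\<close>, together with \<open>max \<C>\<close> if \<open>b\<close> is maximal. Finiteness enters here, because an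
  element below \<open>b\<close> fails to be maximal only if \<open>max \<C>\<close> is nonempty.
\<close>

section \<open>Partial orders as sets of pairs, and existence of maximal elements\<close>

lemma posets_iff:
  "r \<in> posets A \<longleftrightarrow> r \<subseteq> A \<times> A \<and> (\<forall>x\<in>A. (x, x) \<in> r) \<and> trans r \<and> antisym r"
  by (auto simp: posets_def partial_order_on_def preorder_on_def refl_on_def)

lemma posetsD:
  assumes "r \<in> posets A"
  shows "(x, y) \<in> r \<Longrightarrow> x \<in> A" "(x, y) \<in> r \<Longrightarrow> y \<in> A" "x \<in> A \<Longrightarrow> (x, x) \<in> r"
    "(x, y) \<in> r \<Longrightarrow> (y, z) \<in> r \<Longrightarrow> (x, z) \<in> r" "(x, y) \<in> r \<Longrightarrow> (y, x) \<in> r \<Longrightarrow> x = y"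
  using assms unfolding posets_iff by (blast dest: transD antisymD)+

lemma posetsI:
  assumes "\<And>x y. (x, y) \<in> r \<Longrightarrow> x \<in> A \<and> y \<in> A" "\<And>x. x \<in> A \<Longrightarrow> (x, x) \<in> r"
    "\<And>x y z. (x, y) \<in> r \<Longrightarrow> (y, z) \<in> r \<Longrightarrow> (x, z) \<in> r"
    "\<And>x y. (x, y) \<in> r \<Longrightarrow> (y, x) \<in> r \<Longrightarrow> x = y"
  shows "r \<in> posets A"
proof -
  have "trans r" "antisym r"
    by (rule transI, erule (1) assms(3)) (rule antisymI, erule (1) assms(4))
  then show ?thesis
    using assms(1,2) by (auto simp: posets_iff)
qed

lemma converse_in_posets [simp]: "r\<inverse> \<in> posets A \<longleftrightarrow> r \<in> posets A"
  by (auto simp: posets_iff)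

text \<open>An element \<open>x\<close> whose up-set has least cardinality is maximal: passing to a
  strictly larger \<open>y\<close> loses \<open>x\<close> by antisymmetry and gains nothing by
  transitivity, so the finite up-set would shrink.\<close>

lemma max_set_nonempty:
  assumes "finite C" "C \<noteq> {}" "t \<in> posets C"
  shows "max_set C t \<noteq> {}"
proof -
  let ?up = "\<lambda>x. {y \<in> C. (x, y) \<in> t}"
  obtain x where x: "x \<in> C" and least: "\<And>y. y \<in> C \<Longrightarrow> card (?up x) \<le> card (?up y)"
    using assms(2) ex_has_least_nat[of "\<lambda>x. x \<in> C" _ "\<lambda>x. card (?up x)"] by blast
  have "y = x" if "y \<in> C" "(x, y) \<in> t" for y
  proof (rule ccontr)
    assume "y \<noteq> x"
    then have "?up y \<subset> ?up x"
      using that x posetsD(3)[OF assms(3) x] posetsD(5)[OF assms(3), of x y]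
        posetsD(4)[OF assms(3), of x y] by auto
    then have "card (?up y) < card (?up x)"
      using assms(1) by (intro psubset_card_mono) auto
    then show False
      using least[OF that(1)] by simp
  qed
  then show ?thesis
    using x by (auto simp: max_set_def)
qed

section \<open>Relabelling and the species of posets\<close>

lemma relabel_subset: "relabel A f r \<subseteq> f ` A \<times> f ` A"
  by (auto simp: relabel_def)

lemma relabel_iff:
  assumes "inj_on f A" "x \<in> A" "y \<in> A"
  shows "(f x, f y) \<in> relabel A f r \<longleftrightarrow> (x, y) \<in> r"
  using assms by (auto simp: relabel_def dest: inj_onD)

lemma relabel_converse: "relabel A f (r\<inverse>) = (relabel A f r)\<inverse>"
  by (auto simp: relabel_def)

lemma relabel_in_posets:
  assumes "inj_on f A" "r \<in> posets A"
  shows "relabel A f r \<in> posets (f ` A)"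
proof (rule posetsI)
  show "x = y" if xy: "(x, y) \<in> relabel A f r" and yx: "(y, x) \<in> relabel A f r" for x y
  proof -
    obtain u v where "u \<in> A" "v \<in> A" "x = f u" "y = f v"
      using xy unfolding relabel_def by blast
    then show ?thesis
      using xy yx posetsD(5)[OF assms(2), of u v] by (simp add: relabel_iff[OF assms(1)])
  qed
  show "(x, z) \<in> relabel A f r"
    if xy: "(x, y) \<in> relabel A f r" and yz: "(y, z) \<in> relabel A f r" for x y z
  proof -
    obtain u v w where "u \<in> A" "v \<in> A" "w \<in> A" "x = f u" "y = f v" "z = f w"
      using xy yz unfolding relabel_def by blast
    then show ?thesis
      using xy yz posetsD(4)[OF assms(2)] by (simp add: relabel_iff[OF assms(1)])
  qed
qed (use posetsD(3)[OF assms(2)] in \<open>auto simp: relabel_def\<close>)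

lemma max_set_relabel:
  assumes "inj_on f B" "x \<in> B"
  shows "f x \<in> max_set (f ` B) (relabel B f s) \<longleftrightarrow> x \<in> max_set B s"
  using assms by (auto simp: max_set_def relabel_iff dest: inj_onD)

interpretation posets: set_species posets relabel
proof
  fix A B :: "'a set" and f :: "'a \<Rightarrow> 'a" and r :: "'a rel"
  assume "bij_betw f A B" "r \<in> posets A"
  then show "relabel A f r \<in> posets B"
    using relabel_in_posets by (auto simp: bij_betw_def)
next
  fix A :: "'a set" and f g :: "'a \<Rightarrow> 'a" and r :: "'a rel"
  assume "\<And>x. x \<in> A \<Longrightarrow> f x = g x"
  then show "relabel A f r = relabel A g r"
    unfolding relabel_def by (metis (no_types, lifting))
next
  fix A :: "'a set" and r :: "'a rel"
  assume "r \<in> posets A"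
  then show "relabel A (\<lambda>x. x) r = r"
    by (auto simp: relabel_def posets_iff)
next
  fix A B C :: "'a set" and f g :: "'a \<Rightarrow> 'a" and r :: "'a rel"
  assume "bij_betw f A B"
  \<comment> \<open>\<open>relabel B g\<close> keeps only pairs with both components in
    \<open>B\<close>, so no pair is lost in the second relabelling once the values of
    \<open>f\<close> are known to lie there.\<close>
  then have "f x \<in> B" if "x \<in> A" for x
    using that by (auto simp: bij_betw_def)
  then show "relabel A (g \<circ> f) r = relabel B g (relabel A f r)"
    by (fastforce simp: relabel_def)
qed

section \<open>The composition \<open>tri_up\<close> and its maximal elements\<close>

lemma in_insert_at_iff: "x \<in> insert_at A a B \<longleftrightarrow> x \<in> A \<and> x \<noteq> a \<or> x \<in> B"
  by (auto simp: insert_at_def)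

text \<open>Restricts a comparison of relations to points of a carrier, where each point can be
  assigned to one of the composed posets.\<close>

lemma rel_eqI:
  assumes "r \<subseteq> A \<times> A" "r' \<subseteq> A \<times> A"
    "\<And>x y. x \<in> A \<Longrightarrow> y \<in> A \<Longrightarrow> (x, y) \<in> r \<longleftrightarrow> (x, y) \<in> r'"
  shows "r = r'"
  using assms by blast

lemma max_setD: "x \<in> max_set B s \<Longrightarrow> x \<in> B"
  by (simp add: max_set_def)

lemma tri_up_subset: "tri_up A a B r s \<subseteq> insert_at A a B \<times> insert_at A a B"
  by (auto simp: tri_up_def insert_at_def dest: max_setD)

text \<open>Since \<open>max_set B s\<close> lies in \<open>B\<close> and \<open>A\<close> is
  disjoint from \<open>B\<close>, only one clause of the definition can concern a given pair. As
  rewrite rules these equivalences settle the later proofs by a case split on where the points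
  lie.\<close>

lemma tri_up_iff:
  assumes "A \<inter> B = {}"
  shows "x \<in> B \<Longrightarrow> y \<in> B \<Longrightarrow> (x, y) \<in> tri_up A a B r s \<longleftrightarrow> (x, y) \<in> s"
    and "x \<in> A \<Longrightarrow> x \<noteq> a \<Longrightarrow> y \<in> A \<Longrightarrow> y \<noteq> a \<Longrightarrow> (x, y) \<in> tri_up A a B r s \<longleftrightarrow> (x, y) \<in> r"
    and "x \<in> A \<Longrightarrow> x \<noteq> a \<Longrightarrow> y \<in> B \<Longrightarrow>
      (x, y) \<in> tri_up A a B r s \<longleftrightarrow> y \<in> max_set B s \<and> (x, a) \<in> r"
    and "x \<in> B \<Longrightarrow> y \<in> A \<Longrightarrow> y \<noteq> a \<Longrightarrow> (x, y) \<in> tri_up A a B r s \<longleftrightarrow> (a, y) \<in> r"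
  using assms by (auto simp: tri_up_def dest: max_setD)

text \<open>The critical chains for transitivity go from \<open>A\<close> to \<open>B\<close> to
  \<open>B\<close>, where the middle point is maximal and so equals the last, and from
  \<open>B\<close> to \<open>A\<close> to \<open>B\<close>, where the middle point would satisfy
  \<open>a\<close> \<le> y \<le> \<open>a\<close> and hence be the removed point
  \<open>a\<close>.\<close>

lemma tri_up_in_posets:
  assumes AB: "A \<inter> B = {}" and "a \<in> A" and r: "r \<in> posets A" and s: "s \<in> posets B"
  shows "tri_up A a B r s \<in> posets (insert_at A a B)"
proof (rule posetsI)
  have cases: "x \<in> A \<and> x \<noteq> a \<and> x \<notin> B \<or> x \<in> B \<and> x \<notin> A \<and> x \<noteq> a" if "x \<in> insert_at A a B" for x
    using that AB \<open>a \<in> A\<close> by (auto simp: insert_at_def)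
  show "x \<in> insert_at A a B \<and> y \<in> insert_at A a B" if "(x, y) \<in> tri_up A a B r s" for x y
    using subsetD[OF tri_up_subset that] by simp
  then have cases': "(x \<in> A \<and> x \<noteq> a \<and> x \<notin> B \<or> x \<in> B \<and> x \<notin> A \<and> x \<noteq> a)
    \<and> (y \<in> A \<and> y \<noteq> a \<and> y \<notin> B \<or> y \<in> B \<and> y \<notin> A \<and> y \<noteq> a)" if "(x, y) \<in> tri_up A a B r s" for x y
    using that cases by blast
  show "(x, x) \<in> tri_up A a B r s" if "x \<in> insert_at A a B" for x
    using cases[OF that] posetsD(3)[OF r] posetsD(3)[OF s] by (auto simp: tri_up_iff[OF AB])
  show "(x, z) \<in> tri_up A a B r s"
    if "(x, y) \<in> tri_up A a B r s" "(y, z) \<in> tri_up A a B r s" for x y z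
    using cases'[OF that(1)] cases'[OF that(2)] that
    by (elim conjE disjE; simp add: tri_up_iff[OF AB] max_set_def;
        (metis posetsD(4,5)[OF r] posetsD(4)[OF s])?)
  \<comment> \<open>A mutual comparison between a point of \<open>A\<close> and one of
    \<open>B\<close> would again put the former both above and below \<open>a\<close>, so only pairs
    on the same side remain.\<close>
  show "x = y" if "(x, y) \<in> tri_up A a B r s" "(y, x) \<in> tri_up A a B r s" for x y
    using cases'[OF that(1)] that
    by (elim conjE disjE; simp add: tri_up_iff[OF AB] max_set_def;
        (metis posetsD(5)[OF r] posetsD(5)[OF s])?)
qed

lemma max_set_tri_up:
  assumes BC: "B \<inter> C = {}" and b: "b \<in> B"
    and "finite C" "C \<noteq> {}" "t \<in> posets C"
  shows "max_set (insert_at B b C) (tri_up B b C s t)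
    = (max_set B s - {b}) \<union> (if b \<in> max_set B s then max_set C t else {})"
    (is "max_set _ ?u = ?R")
proof (rule set_eqI)
  let ?L = "max_set (insert_at B b C) ?u"
  fix x
  obtain m where m: "m \<in> max_set C t"
    using max_set_nonempty assms(3-5) by blast
  then have "m \<in> C"
    by (rule max_setD)
  consider "x \<in> B" "x \<noteq> b" "x \<notin> C" | "x \<in> C" "x \<notin> B" | "x \<notin> insert_at B b C"
    using BC by (auto simp: insert_at_def)
  then show "x \<in> ?L \<longleftrightarrow> x \<in> ?R"
  proof cases
    case 1
    have "x \<in> ?L \<longleftrightarrow> (\<forall>y\<in>B - {b}. (x, y) \<in> ?u \<longrightarrow> y = x) \<and> (\<forall>y\<in>C. (x, y) \<in> ?u \<longrightarrow> y = x)"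
      using 1 by (simp add: max_set_def insert_at_def ball_Un)
    also have "\<dots> \<longleftrightarrow> (\<forall>y\<in>B - {b}. (x, y) \<in> s \<longrightarrow> y = x)
        \<and> (\<forall>y\<in>C. y \<in> max_set C t \<and> (x, b) \<in> s \<longrightarrow> y = x)"
      using 1 by (simp add: tri_up_iff[OF BC])
    \<comment> \<open>As \<open>x\<close> lies outside \<open>C\<close>, the equality
      \<open>y = x\<close> fails on \<open>C\<close>, and \<open>m\<close> refutes the left side
      whenever \<open>x\<close> is below \<open>b\<close>.\<close>
    also have "(\<forall>y\<in>C. y \<in> max_set C t \<and> (x, b) \<in> s \<longrightarrow> y = x) \<longleftrightarrow> (x, b) \<notin> s"
      using 1 m \<open>m \<in> C\<close> by metis
    also have "(\<forall>y\<in>B - {b}. (x, y) \<in> s \<longrightarrow> y = x) \<and> (x, b) \<notin> s \<longleftrightarrow> x \<in> max_set B s"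
      unfolding max_set_def mem_Collect_eq using 1 b by (metis Diff_iff singleton_iff)
    finally show ?thesis
      using 1 by (auto dest: max_setD)
  next
    case 2
    have "x \<in> ?L \<longleftrightarrow> (\<forall>y\<in>B - {b}. (x, y) \<in> ?u \<longrightarrow> y = x) \<and> (\<forall>y\<in>C. (x, y) \<in> ?u \<longrightarrow> y = x)"
      using 2 by (simp add: max_set_def insert_at_def ball_Un)
    also have "\<dots> \<longleftrightarrow> (\<forall>y\<in>B - {b}. (b, y) \<in> s \<longrightarrow> y = x) \<and> (\<forall>y\<in>C. (x, y) \<in> t \<longrightarrow> y = x)"
      using 2 by (simp add: tri_up_iff[OF BC])
    also have "(\<forall>y\<in>C. (x, y) \<in> t \<longrightarrow> y = x) \<longleftrightarrow> x \<in> max_set C t"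
      using 2 by (simp add: max_set_def)
    \<comment> \<open>Here \<open>x\<close> lies outside \<open>B\<close>, so the left side says
      that no other element of \<open>B\<close> is above \<open>b\<close>.\<close>
    also have "(\<forall>y\<in>B - {b}. (b, y) \<in> s \<longrightarrow> y = x) \<longleftrightarrow> b \<in> max_set B s"
      using 2 b by (simp add: max_set_def) (metis Diff_iff singleton_iff)
    finally show ?thesis
      using 2 by (auto dest: max_setD)
  next
    case 3
    then show ?thesis
      by (auto simp: insert_at_def dest: max_setD split: if_splits)
  qed
qed

section \<open>Naturality, associativity and the right unit for \<open>tri_up\<close>\<close>

lemma tri_up_natural:
  assumes AB: "A \<inter> B = {}" and a: "a \<in> A"
    and f: "bij_betw f A A'" and g: "bij_betw g B B'" and AB': "A' \<inter> B' = {}"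
  shows "relabel (insert_at A a B) (\<lambda>x. if x \<in> B then g x else f x) (tri_up A a B r s)
    = tri_up A' (f a) B' (relabel A f r) (relabel B g s)"
    (is "relabel ?S ?h _ = ?R")
proof (rule rel_eqI)
  have fA: "f ` A = A'" and gB: "g ` B = B'" and injf: "inj_on f A" and injg: "inj_on g B"
    using f g by (auto simp: bij_betw_def)
  have inA: "x \<notin> B" "f x \<in> A'" if "x \<in> A" for x
    using that AB fA by auto
  have inB: "g x \<in> B'" if "x \<in> B" for x
    using that gB by auto
  \<comment> \<open>Points of \<open>A\<close> other than \<open>a\<close> must avoid
    \<open>f a\<close>, so that they meet the side conditions of the composition at
    \<open>f a\<close>.\<close>
  have fa: "f x = f a \<longleftrightarrow> x = a" if "x \<in> A" for x
    using that a injf by (auto dest: inj_onD)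
  have gmax: "g x \<in> max_set B' (relabel B g s) \<longleftrightarrow> x \<in> max_set B s" if "x \<in> B" for x
    using max_set_relabel[OF injg that] gB by simp
  have cases: "x \<in> A \<and> x \<noteq> a \<and> x \<notin> B \<or> x \<in> B" if "x \<in> ?S" for x
    using that AB by (auto simp: insert_at_def)
  have hS: "?h ` ?S = insert_at A' (f a) B'"
  proof -
    have "?h ` (A - {a}) = f ` A - {f a}" "?h ` B = B'"
      using inA fa gB by auto
    then show ?thesis
      unfolding insert_at_def image_Un using fA by simp
  qed
  \<comment> \<open>The images of points from \<open>A\<close> and from \<open>B\<close> cannot
    collide because \<open>A'\<close> and \<open>B'\<close> are disjoint. Injectivity then lets both
    relations be tested on pairs \<open>(?h x, ?h y)\<close>.\<close>
  have injh: "inj_on ?h ?S"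
  proof (rule inj_onI)
    show "x = y" if "x \<in> ?S" "y \<in> ?S" "?h x = ?h y" for x y
      using cases[OF that(1)] cases[OF that(2)] that(3) AB' inA(2)[of x] inA(2)[of y]
        inB[of x] inB[of y] inj_onD[OF injf, of x y] inj_onD[OF injg, of x y]
      by (elim disjE conjE) auto
  qed
  show "?R \<subseteq> insert_at A' (f a) B' \<times> insert_at A' (f a) B'"
    by (rule tri_up_subset)
  show "relabel ?S ?h (tri_up A a B r s) \<subseteq> insert_at A' (f a) B' \<times> insert_at A' (f a) B'"
    using relabel_subset hS by metis
  have "(?h x, ?h y) \<in> relabel ?S ?h (tri_up A a B r s) \<longleftrightarrow> (?h x, ?h y) \<in> ?R"
    if "x \<in> ?S" "y \<in> ?S" for x y
    unfolding relabel_iff[OF injh that] using cases[OF that(1)] cases[OF that(2)]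
    by (elim disjE conjE; simp add: a inA inB fa gmax tri_up_iff[OF AB] tri_up_iff[OF AB']
        relabel_iff[OF injf] relabel_iff[OF injg])
  then show "(x, y) \<in> relabel ?S ?h (tri_up A a B r s) \<longleftrightarrow> (x, y) \<in> ?R"
    if "x \<in> insert_at A' (f a) B'" "y \<in> insert_at A' (f a) B'" for x y
    using that unfolding hS[symmetric] by blast
qed

text \<open>The only interaction of the two insertions is between \<open>B\<close> and
  \<open>C\<close>: in either order, a point of \<open>B\<close> is below a point of
  \<open>C\<close> exactly when the latter is in \<open>max_set C t\<close> and
  \<open>(a, a') \<in> r\<close>, and symmetrically from \<open>C\<close> to
  \<open>B\<close>.\<close>

lemma tri_up_parallel_assoc:
  assumes disj: "A \<inter> B = {}" "A \<inter> C = {}" "B \<inter> C = {}"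
    and a: "a \<in> A" "a' \<in> A" "a \<noteq> a'"
  shows "tri_up (insert_at A a B) a' C (tri_up A a B r s) t
    = tri_up (insert_at A a' C) a B (tri_up A a' C r t) s"
    (is "?L = ?R")
proof (rule rel_eqI)
  let ?S = "(A - {a, a'}) \<union> B \<union> C"
  have S: "insert_at (insert_at A a B) a' C = ?S" "insert_at (insert_at A a' C) a B = ?S"
    using assms by (auto simp: insert_at_def)
  show "?L \<subseteq> ?S \<times> ?S" "?R \<subseteq> ?S \<times> ?S"
    using tri_up_subset S by metis+
  have disj': "insert_at A a B \<inter> C = {}" "insert_at A a' C \<inter> B = {}"
    using disj by (auto simp: insert_at_def)
  note iffs = disj[THEN tri_up_iff(1)] disj[THEN tri_up_iff(2)] disj[THEN tri_up_iff(3)]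
    disj[THEN tri_up_iff(4)] disj'[THEN tri_up_iff(1)] disj'[THEN tri_up_iff(2)]
    disj'[THEN tri_up_iff(3)] disj'[THEN tri_up_iff(4)]
  have cases: "x \<in> A \<and> x \<noteq> a \<and> x \<noteq> a' \<or> x \<in> B \<and> x \<noteq> a \<and> x \<noteq> a' \<or> x \<in> C \<and> x \<noteq> a \<and> x \<noteq> a'"
    if "x \<in> ?S" for x
    using that disj a by auto
  show "(x, y) \<in> ?L \<longleftrightarrow> (x, y) \<in> ?R" if "x \<in> ?S" "y \<in> ?S" for x y
    using cases[OF that(1)] cases[OF that(2)] a a(3)[symmetric]
    by (elim disjE conjE; simp add: iffs in_insert_at_iff)
qed

text \<open>The decisive pairs go from \<open>A\<close> to \<open>C\<close>: the left side asks that
  the point of \<open>C\<close> be maximal there and that \<open>b\<close> be maximal in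
  \<open>B\<close>, which is the criterion of \<open>max_set_tri_up\<close> for maximality in the
  inner composite on the right.\<close>

lemma tri_up_nested_assoc:
  assumes disj: "A \<inter> B = {}" "A \<inter> C = {}" "B \<inter> C = {}" and ab: "a \<in> A" "b \<in> B"
    and "finite C" "C \<noteq> {}" "t \<in> posets C"
  shows "tri_up (insert_at A a B) b C (tri_up A a B r s) t
    = tri_up A a (insert_at B b C) r (tri_up B b C s t)"
    (is "?L = ?R")
proof (rule rel_eqI)
  let ?S = "(A - {a}) \<union> (B - {b}) \<union> C"
  have S: "insert_at (insert_at A a B) b C = ?S" "insert_at A a (insert_at B b C) = ?S"
    using disj ab by (auto simp: insert_at_def)
  show "?L \<subseteq> ?S \<times> ?S" "?R \<subseteq> ?S \<times> ?S"
    using tri_up_subset S by metis+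
  have disj': "insert_at A a B \<inter> C = {}" "A \<inter> insert_at B b C = {}"
    using disj by (auto simp: insert_at_def)
  note iffs = disj[THEN tri_up_iff(1)] disj[THEN tri_up_iff(2)] disj[THEN tri_up_iff(3)]
    disj[THEN tri_up_iff(4)] disj'[THEN tri_up_iff(1)] disj'[THEN tri_up_iff(2)]
    disj'[THEN tri_up_iff(3)] disj'[THEN tri_up_iff(4)]
    max_set_tri_up[OF disj(3) assms(5-8)]
  \<comment> \<open>The non-membership facts decide which part of the union in
    \<open>max_set_tri_up\<close> a point can belong to.\<close>
  have cases: "x \<in> A \<and> x \<noteq> a \<and> x \<noteq> b \<or> x \<in> B \<and> x \<noteq> a \<and> x \<noteq> b \<and> x \<notin> max_set C t
      \<or> x \<in> C \<and> x \<noteq> a \<and> x \<noteq> b \<and> x \<notin> max_set B s"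
    if "x \<in> ?S" for x
    using that disj ab by (auto dest: max_setD)
  show "(x, y) \<in> ?L \<longleftrightarrow> (x, y) \<in> ?R" if "x \<in> ?S" "y \<in> ?S" for x y
    using cases[OF that(1)] cases[OF that(2)] ab
    by (elim disjE conjE; simp add: iffs in_insert_at_iff)
qed

text \<open>The single point \<open>b\<close> is maximal in its poset, so it inherits every
  comparison of \<open>a\<close>; reflexivity of \<open>r\<close> at \<open>a\<close> matches the
  pair \<open>(b, b)\<close>.\<close>

lemma tri_up_right_unit:
  assumes "a \<in> A" "b \<notin> A" "r \<in> posets A"
  shows "tri_up A a {b} r (one_point_poset b) = relabel A (\<lambda>x. if x = a then b else x) r"
    (is "?L = relabel A ?h r")
proof (rule rel_eqI)
  have hA: "?h ` A = insert_at A a {b}"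
  proof
    show "?h ` A \<subseteq> insert_at A a {b}"
      by (rule image_subsetI) (simp add: in_insert_at_iff)
    show "insert_at A a {b} \<subseteq> ?h ` A"
    proof
      show "y \<in> ?h ` A" if "y \<in> insert_at A a {b}" for y
        \<comment> \<open>The new label \<open>b\<close> comes from \<open>a\<close>; every other
          point is fixed.\<close>
        by (rule image_eqI[where x = "if y = b then a else y"])
          (use that assms(1,2) in \<open>auto simp: in_insert_at_iff\<close>)
    qed
  qed
  have injh: "inj_on ?h A"
    using assms(2) by (intro inj_onI) (metis (full_types))
  have Ab: "A \<inter> {b} = {}"
    using assms(2) by simp
  show "?L \<subseteq> insert_at A a {b} \<times> insert_at A a {b}"
    by (rule tri_up_subset)
  show "relabel A ?h r \<subseteq> insert_at A a {b} \<times> insert_at A a {b}"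
    using relabel_subset hA by metis
  have "(?h x, ?h y) \<in> ?L \<longleftrightarrow> (?h x, ?h y) \<in> relabel A ?h r" if "x \<in> A" "y \<in> A" for x y
    unfolding relabel_iff[OF injh that] using that posetsD(3)[OF assms(3,1)]
    by (simp add: tri_up_iff[OF Ab] max_set_def one_point_poset_def)
  then show "(x, y) \<in> ?L \<longleftrightarrow> (x, y) \<in> relabel A ?h r"
    if "x \<in> insert_at A a {b}" "y \<in> insert_at A a {b}" for x y
    using that unfolding hA[symmetric] by blast
qed

section \<open>The two operad structures\<close>

interpretation tri_up: set_operad posets relabel tri_up one_point_poset
proof
  show "one_point_poset a \<in> posets {a}" for a :: 'a
    by (rule posetsI) (auto simp: one_point_poset_def)
  \<comment> \<open>\<open>{a} - {a}\<close> is empty, so what remains is \<open>s\<close>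
    restricted to \<open>B\<close>, which is \<open>s\<close> itself.\<close>
  show "tri_up {a} a B (one_point_poset a) s = s" if "a \<notin> B" "s \<in> posets B"
    for a B and s :: "'a rel"
    using that(1) posetsD(1,2)[OF that(2)] by (auto simp: tri_up_def one_point_poset_def)
qed (simp_all add: tri_up_in_posets tri_up_natural tri_up_nested_assoc tri_up_right_unit,
    rule tri_up_parallel_assoc)

text \<open>Reversal turns minimal elements into maximal ones and exchanges the two clauses between
  \<open>A\<close> and \<open>B\<close>.\<close>

lemma tri_down_eq: "tri_down A a B r s = (tri_up A a B (r\<inverse>) (s\<inverse>))\<inverse>"
  by (auto simp: tri_down_def tri_up_def min_set_def max_set_def)

lemma one_point_poset_converse: "(one_point_poset a)\<inverse> = one_point_poset a"
  by (auto simp: one_point_poset_def)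

text \<open>Each axiom is that of \<open>tri_up\<close> at the converse relations: converses of
  posets are posets, \<open>relabel\<close> commutes with converse, and the unit is its own
  converse.\<close>

interpretation tri_down: set_operad posets relabel tri_down one_point_poset
proof
  show "relabel (insert_at A a B) (\<lambda>x. if x \<in> B then g x else f x) (tri_down A a B r s)
      = tri_down A' (f a) B' (relabel A f r) (relabel B g s)"
    if "A \<inter> B = {}" "a \<in> A" "bij_betw f A A'" "bij_betw g B B'" "A' \<inter> B' = {}"
    for A B A' B' a f g and r s :: "'a rel"
    using tri_up_natural[OF that] by (simp add: tri_down_eq relabel_converse)
  show "tri_down (insert_at A a B) a' C (tri_down A a B r s) t
      = tri_down (insert_at A a' C) a B (tri_down A a' C r t) s"
    if "A \<inter> B = {}" "A \<inter> C = {}" "B \<inter> C = {}" "a \<in> A" "a' \<in> A" "a \<noteq> a'"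
    for A B C a a' and r s t :: "'a rel"
    using tri_up_parallel_assoc[OF that] by (simp add: tri_down_eq)
qed (simp_all add: tri_down_eq relabel_converse one_point_poset_converse tri_up.one_in
      tri_up_in_posets tri_up_nested_assoc tri_up.left_unit tri_up_right_unit)

theorem theorem7:
  shows "set_operad (posets :: 'a set \<Rightarrow> 'a rel set) relabel tri_up one_point_poset \<and>
         set_operad (posets :: 'a set \<Rightarrow> 'a rel set) relabel tri_down one_point_poset"
  by (simp add: tri_up.set_operad_axioms tri_down.set_operad_axioms)

end
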